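(* Let $X$ be a $G$-Banach space with $G$-norm $\|\cdot,\cdot,\cdot\|$, let $k\in[0,1)$, and let $T\colon X\to X$ be a mapping such that for all $x,y,z\in X$ $$\|Tx-Ty,\,Ty-Tz,\,Tz-Tx\|\le k\,\|x-y,\,y-z,\,z-x\|.$$ Then $T$ has a unique fixed point.
   Context: A $G$-norm on a real vector space $X$ is a function $\|\cdot,\cdot,\cdot\|\colon X^3\to\mathbb{R}$ such that: [N1] $\|x,y,z\|\ge 0$, and $\|x,y,z\|=0$ if and only if $x=y=z=0$; [N2] $\|x,y,z\|$ is invariant under permutations of $x,y,z$; [N3] $\|\alpha x,\alpha y,\alpha z\|=|\alpha|\,\|x,y,z\|$ for all $\alpha\in\mathbb{R}$, $x,y,z\in X$; [N4] $\|x+x',y+y',z+z'\|\le\|x,y,z\|+\|x',y',z'\|$ for all $x,y,z,x',y',z'\in X$; [N5] $\|x,y,z\|\ge\|x+y,0,z\|$ for all $x,y,z\in X$. The pair $(X,\|\cdot,\cdot,\cdot\|)$ is then called a $G$-normed space. A sequence $(x_n)$ in $X$ converges to $x\in X$ if for every $\epsilon>0$ there is a positive integer $N$ such that $l,m,n\ge N$ implies $\|x_l-x,\,x_m-x,\,x_n-x\|<\epsilon$. A sequence $(x_n)$ in $X$ is a Cauchy sequence if for every $\epsilon>0$ there is a positive integer $N$ such that $l,m,n\ge N$ implies $\|x_l-x_m,\,x_m-x_n,\,x_n-x_l\|<\epsilon$. A $G$-normed space is complete if each Cauchy sequence in $X$ converges in $X$. A complete $G$-normed space is called a $G$-Banach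 space. *)

theory Defs
  imports "HOL-Analysis.Analysis"
begin

locale G_normed_space =
  fixes G :: "'a::real_vector \<Rightarrow> 'a \<Rightarrow> 'a \<Rightarrow> real"
  assumes nonneg: "G x y z \<ge> 0"
    and eq_zero_iff: "G x y z = 0 \<longleftrightarrow> x = 0 \<and> y = 0 \<and> z = 0"
    \<comment> \<open>The two transpositions generate all permutations of the three arguments.\<close>
    and swap_first: "G x y z = G y x z"
    and swap_last: "G x y z = G x z y"
    and scale: "G (\<alpha> *\<^sub>R x) (\<alpha> *\<^sub>R y) (\<alpha> *\<^sub>R z) = \<bar>\<alpha>\<bar> * G x y z"
    and triangle: "G (x + x') (y + y') (z + z') \<le> G x y z + G x' y' z'"
    and add_le: "G x y z \<ge> G (x + y) 0 z"
begin

definition G_converges :: "(nat \<Rightarrow> 'a) \<Rightarrow> 'a \<Rightarrow> bool" where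
  "G_converges s x \<longleftrightarrow>
    (\<forall>\<epsilon>>0. \<exists>N. \<forall>l\<ge>N. \<forall>m\<ge>N. \<forall>n\<ge>N. G (s l - x) (s m - x) (s n - x) < \<epsilon>)"

definition G_Cauchy :: "(nat \<Rightarrow> 'a) \<Rightarrow> bool" where
  "G_Cauchy s \<longleftrightarrow>
    (\<forall>\<epsilon>>0. \<exists>N. \<forall>l\<ge>N. \<forall>m\<ge>N. \<forall>n\<ge>N. G (s l - s m) (s m - s n) (s n - s l) < \<epsilon>)"

end

locale G_Banach_space = G_normed_space +
  assumes G_complete: "G_Cauchy s \<Longrightarrow> \<exists>x. G_converges s x"

end

theory Submission
  imports Defs
begin

text \<open>
  The diagonal \<open>u \<mapsto> G u 0 (- u)\<close> of a \<open>G\<close>-norm is an ordinary norm on \<open>X\<close>, here called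
  \<open>diag_norm\<close>. Contractivity for the triple \<open>(x, y, y)\<close> says precisely that \<open>T\<close> is a
  \<open>k\<close>-contraction for the distance that this norm induces, so the statement reduces to Banach's
  fixed point theorem as soon as that distance is known to be complete. Completeness transfers
  from \<open>G\<close> by two comparisons:
  \<^item> \<open>G u v w \<le> diag_norm u + diag_norm v\<close> whenever \<open>u + v + w = 0\<close>, so that a Cauchy sequence
    for the distance is \<open>G\<close>-Cauchy (lemma \<open>G_zero_sum_le\<close>);
  \<^item> \<open>diag_norm u \<le> G u u u\<close>, so that a \<open>G\<close>-limit is a limit for the distance
    (lemma \<open>diag_norm_le_G\<close>).
\<close>

context G_normed_space
begin

definition diag_norm :: "'a \<Rightarrow> real" where
  "diag_norm u = G u 0 (- u)"

lemma swap_outer: "G x y z = G z y x"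
  by (metis swap_first swap_last)

lemma diag_norm_nonneg: "0 \<le> diag_norm u"
  by (simp add: diag_norm_def nonneg)

lemma diag_norm_eq_0_iff: "diag_norm u = 0 \<longleftrightarrow> u = 0"
  by (simp add: diag_norm_def eq_zero_iff)

lemma diag_norm_minus: "diag_norm (- u) = diag_norm u"
  unfolding diag_norm_def using swap_outer[of "- u" 0 u] by simp

lemma diag_norm_triangle: "diag_norm (u + v) \<le> diag_norm u + diag_norm v"
  unfolding diag_norm_def using triangle[of u v 0 0 "- u" "- v"] by (simp add: add.commute)

text \<open>
  A triple with sum zero splits as \<open>(u, 0, - u) + (0, v, - v)\<close>, and each summand is a permuted
  diagonal triple. The triples \<open>(x - y, y - z, z - x)\<close> of the Cauchy condition are of this form.
\<close>
lemma G_zero_sum_le: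
  assumes "u + v + w = 0"
  shows "G u v w \<le> diag_norm u + diag_norm v"
proof -
  have "w = - u + - v"
    using assms by (simp add: algebra_simps eq_neg_iff_add_eq_0)
  then have "G u v w = G (u + 0) (0 + v) (- u + - v)"
    by simp
  also have "\<dots> \<le> G u 0 (- u) + G 0 v (- v)"
    by (rule triangle)
  also have "G 0 v (- v) = diag_norm v"
    unfolding diag_norm_def by (rule swap_first)
  finally show ?thesis
    by (simp add: diag_norm_def)
qed

text \<open>
  Merging the three equal arguments by the fifth axiom gives \<open>G (3 u) 0 0 \<le> G u u u\<close>, that is,
  \<open>3 * G u 0 0 \<le> G u u u\<close>, while the triangle inequality gives \<open>diag_norm u \<le> 2 * G u 0 0\<close>.
\<close>
lemma diag_norm_le_G: "diag_norm u \<le> G u u u"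
proof -
  have "G (u + u + u) 0 0 \<le> G (u + u) u 0"
    by (rule add_le)
  also have "\<dots> = G (u + u) 0 u"
    by (rule swap_last)
  also have "\<dots> \<le> G u u u"
    by (rule add_le)
  finally have merged: "G (u + u + u) 0 0 \<le> G u u u" .
  have "u + u + u = 3 *\<^sub>R u"
    using scaleR_add_left[of 2 1 u] by (simp add: scaleR_2)
  then have three: "3 * G u 0 0 \<le> G u u u"
    using merged scale[of 3 u 0 0] by simp
  have "G (u + 0) (0 + 0) (0 + - u) \<le> G u 0 0 + G 0 0 (- u)"
    by (rule triangle)
  moreover have "G 0 0 (- u) = G u 0 0"
    using scale[of "-1" 0 0 u] swap_outer[of 0 0 u] by simp
  ultimately have "diag_norm u \<le> 2 * G u 0 0"
    by (simp add: diag_norm_def)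
  with three nonneg[of u 0 0] show ?thesis
    by linarith
qed

lemma Metric_space_diag_norm: "Metric_space UNIV (\<lambda>x y. diag_norm (x - y))"
proof
  show "diag_norm (x - y) = diag_norm (y - x)" for x y
    using diag_norm_minus[of "x - y"] by simp
  show "diag_norm (x - z) \<le> diag_norm (x - y) + diag_norm (y - z)" for x y z
    using diag_norm_triangle[of "x - y" "y - z"] by simp
qed (simp_all add: diag_norm_nonneg diag_norm_eq_0_iff)

lemma G_CauchyI:
  assumes "\<And>\<epsilon>. \<epsilon> > 0 \<Longrightarrow> \<exists>N. \<forall>m\<ge>N. \<forall>n\<ge>N. diag_norm (s m - s n) < \<epsilon>"
  shows "G_Cauchy s"
  unfolding G_Cauchy_def
proof (intro allI impI)
  fix \<epsilon> :: real
  assume "\<epsilon> > 0"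
  then obtain N where N: "\<And>m n. m \<ge> N \<Longrightarrow> n \<ge> N \<Longrightarrow> diag_norm (s m - s n) < \<epsilon> / 2"
    using assms[of "\<epsilon> / 2"] by auto
  have "G (s l - s m) (s m - s n) (s n - s l) < \<epsilon>" if "l \<ge> N" "m \<ge> N" "n \<ge> N" for l m n
    using G_zero_sum_le[of "s l - s m" "s m - s n" "s n - s l"] N[of l m] N[of m n] that
    by simp
  then show "\<exists>N. \<forall>l\<ge>N. \<forall>m\<ge>N. \<forall>n\<ge>N. G (s l - s m) (s m - s n) (s n - s l) < \<epsilon>"
    by blast
qed

lemma G_converges_imp_diag_norm:
  assumes "G_converges s x" and "\<epsilon> > 0"
  shows "\<exists>N. \<forall>n\<ge>N. diag_norm (s n - x) < \<epsilon>"
  using assms unfolding G_converges_def by (meson diag_norm_le_G le_less_trans)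

end

lemma (in G_Banach_space) mcomplete_diag_norm:
  "Metric_space.mcomplete UNIV (\<lambda>x y. diag_norm (x - y))"
proof -
  interpret Metric_space UNIV "\<lambda>x y. diag_norm (x - y)"
    by (rule Metric_space_diag_norm)
  show ?thesis
    unfolding mcomplete_def
  proof (intro allI impI)
    fix s
    assume "MCauchy s"
    then have "G_Cauchy s"
      by (intro G_CauchyI) (auto simp: MCauchy_def)
    then obtain x where "G_converges s x"
      using G_complete by blast
    then have "limitin mtopology s x sequentially"
      by (auto simp: limit_metric_sequentially dest: G_converges_imp_diag_norm)
    then show "\<exists>x. limitin mtopology s x sequentially" ..
  qed
qed

theorem theorem2p17:
  fixes G :: "'a::real_vector \<Rightarrow> 'a \<Rightarrow> 'a \<Rightarrow> real"
    and k :: real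
    and T :: "'a \<Rightarrow> 'a"
  assumes "G_Banach_space G"
    and "0 \<le> k" and "k < 1"
    and "\<And>x y z. G (T x - T y) (T y - T z) (T z - T x) \<le> k * G (x - y) (y - z) (z - x)"
  shows "\<exists>!x. T x = x"
proof -
  interpret G_Banach_space G
    by (rule assms(1))
  interpret Metric_space UNIV "\<lambda>x y. diag_norm (x - y)"
    by (rule Metric_space_diag_norm)
  have contraction: "diag_norm (T x - T y) \<le> k * diag_norm (x - y)" for x y
    using assms(4)[of x y y] by (simp add: diag_norm_def)
  obtain x where x: "T x = x"
    using Banach_fixedpoint_thm[OF mcomplete_diag_norm, of T k] \<open>k < 1\<close> contraction by auto
  have "y = x" if "T y = y" for y
  proof -
    have "(1 - k) * diag_norm (y - x) \<le> 0"
      using contraction[of y x] that x by (simp add: algebra_simps)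
    then show ?thesis
      using \<open>k < 1\<close> diag_norm_nonneg[of "y - x"] diag_norm_eq_0_iff[of "y - x"]
      by (auto simp: mult_le_0_iff)
  qed
  with x show ?thesis
    by blast
qed

end
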